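(* Let $(X_n, n\ge 1)$ be a stationary $1$-dependent sequence of $\{0,1\}$-valued random variables, with partial sums $S_0:=0$, $S_n := X_1+\cdots+X_n$. Let $$Q(z,v)=\sum_{n\ge 0}\sum_{k\ge 0}\mathbb{P}(S_n=k)z^kv^n,\qquad Q(v)=\sum_{n\ge 0}\mathbb{P}(S_n=0)v^n,\qquad P(v)=\sum_{n\ge 0}\mathbb{P}(S_n=n)v^n$$ be respectively the bivariate generating function of the distributions of the $S_n$, the $0$-run probability generating function, and the $1$-run probability generating function. Then $Q(z,v)$ is determined either by $Q(v)$ or by $P(v)$, via the formulae $$Q(z,v)=\frac{Q((1-z)v)}{1-zv\,Q((1-z)v)}=\frac{P(-(1-z)v)}{1-v\,P(-(1-z)v)}.$$
   Context: A sequence of random variables $(X_1,X_2,\ldots)$ is $1$-dependent if $(X_1,\ldots,X_{m-1})$ is independent of $(X_{m+1},\ldots,X_{m+n})$ for all positive integers $m$ and $n$. It is stationary if $(X_1,\ldots,X_n)$ has the same distribution as $(X_2,\ldots,X_{n+1})$ for every positive integer $n$. The $n=0$ terms of all three generating functions are equal to $1$. The formulae are identities of formal power series in $v$ whose coefficients are polynomials in $z$; the denominators have constant term $1$ in $v$, hence are invertible as power series. *)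

theory Defs
  imports "HOL-Probability.Probability" "HOL-Computational_Algebra.Formal_Power_Series"
begin

text \<open>
  A sequence \<open>(X\<^sub>1, X\<^sub>2, \<dots>)\<close> is a function on \<^typ>\<open>nat\<close> whose value at index 0 is never used.
  The parameter \<open>N\<close> is the common measurable space in which the \<open>X\<^sub>n\<close> take their values.
\<close>

definition random_sequence :: "'a measure \<Rightarrow> 'b measure \<Rightarrow> (nat \<Rightarrow> 'a \<Rightarrow> 'b) \<Rightarrow> bool" where
  "random_sequence M N X \<longleftrightarrow> (\<forall>n\<ge>1. X n \<in> M \<rightarrow>\<^sub>M N)"

definition one_dependent :: "'a measure \<Rightarrow> 'b measure \<Rightarrow> (nat \<Rightarrow> 'a \<Rightarrow> 'b) \<Rightarrow> bool" where
  "one_dependent M N X \<longleftrightarrow> (\<forall>m\<ge>1. \<forall>n\<ge>1.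
     prob_space.indep_var M
       (\<Pi>\<^sub>M i\<in>{1..<m}. N) (\<lambda>\<omega>. \<lambda>i\<in>{1..<m}. X i \<omega>)
       (\<Pi>\<^sub>M i\<in>{m+1..m+n}. N) (\<lambda>\<omega>. \<lambda>i\<in>{m+1..m+n}. X i \<omega>))"

definition stationary :: "'a measure \<Rightarrow> 'b measure \<Rightarrow> (nat \<Rightarrow> 'a \<Rightarrow> 'b) \<Rightarrow> bool" where
  "stationary M N X \<longleftrightarrow> (\<forall>n\<ge>1.
     distr M (\<Pi>\<^sub>M i\<in>{1..n}. N) (\<lambda>\<omega>. \<lambda>i\<in>{1..n}. X i \<omega>) =
     distr M (\<Pi>\<^sub>M i\<in>{1..n}. N) (\<lambda>\<omega>. \<lambda>i\<in>{1..n}. X (i + 1) \<omega>))"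

definition partial_sum :: "(nat \<Rightarrow> 'a \<Rightarrow> nat) \<Rightarrow> nat \<Rightarrow> 'a \<Rightarrow> nat" where
  "partial_sum X n \<omega> = (\<Sum>i=1..n. X i \<omega>)"

text \<open>
  Power series in \<open>v\<close> (the series variable \<^const>\<open>fps_X\<close>) over polynomials in \<open>z\<close>. The sum over
  \<open>k\<close> stops at \<open>n\<close>: for \<open>{0,1}\<close>-valued variables the later terms vanish; see
  \<open>coeff_bivariate_gf\<close> below.
\<close>

definition bivariate_gf :: "'a measure \<Rightarrow> (nat \<Rightarrow> 'a \<Rightarrow> nat) \<Rightarrow> real poly fps" where
  "bivariate_gf M X = Abs_fps (\<lambda>n. \<Sum>k\<le>n. monom \<P>(\<omega> in M. partial_sum X n \<omega> = k) k)"

definition zero_run_gf :: "'a measure \<Rightarrow> (nat \<Rightarrow> 'a \<Rightarrow> nat) \<Rightarrow> real fps" where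
  "zero_run_gf M X = Abs_fps (\<lambda>n. \<P>(\<omega> in M. partial_sum X n \<omega> = 0))"

definition one_run_gf :: "'a measure \<Rightarrow> (nat \<Rightarrow> 'a \<Rightarrow> nat) \<Rightarrow> real fps" where
  "one_run_gf M X = Abs_fps (\<lambda>n. \<P>(\<omega> in M. partial_sum X n \<omega> = n))"

lemma coeff_bivariate_gf:
  assumes "random_sequence M (count_space {0, 1}) X"
  shows "coeff (fps_nth (bivariate_gf M X) n) k = \<P>(\<omega> in M. partial_sum X n \<omega> = k)"
proof (cases "k \<le> n")
  case True
  then show ?thesis
    by (simp add: bivariate_gf_def coeff_sum)
next
  case False
  have "partial_sum X n \<omega> \<le> n" if "\<omega> \<in> space M" for \<omega>
  proof -
    have "X i \<omega> \<le> 1" if "i \<in> {1..n}" for i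
    proof -
      have "X i \<in> M \<rightarrow>\<^sub>M count_space {0, 1}"
        using assms that by (simp add: random_sequence_def)
      from measurable_space[OF this \<open>\<omega> \<in> space M\<close>] show ?thesis
        by auto
    qed
    then have "(\<Sum>i=1..n. X i \<omega>) \<le> (\<Sum>i=1..n. 1)"
      by (intro sum_mono) auto
    then show ?thesis
      by (simp add: partial_sum_def)
  qed
  with False have "{\<omega> \<in> space M. partial_sum X n \<omega> = k} = {}"
    by auto
  with False show ?thesis
    by (simp add: bivariate_gf_def coeff_sum del: Collect_empty_eq)
qed

text \<open>A series with real coefficients, regarded as one whose coefficients are constant polynomials.\<close>

definition fps_of_real_fps :: "real fps \<Rightarrow> real poly fps" where
  "fps_of_real_fps F = Abs_fps (\<lambda>n. [:fps_nth F n:])"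

text \<open>
  Polynomials have no \<^const>\<open>inverse\<close>, so \<^typ>\<open>real poly fps\<close> has no division. This is the
  quotient by a series with constant term 1; it is meaningful only for such denominators.
\<close>

definition fps_quot :: "'a::comm_ring_1 fps \<Rightarrow> 'a fps \<Rightarrow> 'a fps" where
  "fps_quot f g = f * fps_right_inverse g 1"

lemma fps_quot_eq_iff:
  assumes "fps_nth g 0 = 1"
  shows "h = fps_quot f g \<longleftrightarrow> h * g = f"
proof -
  have inv: "g * fps_right_inverse g 1 = 1"
    using assms by (intro fps_right_inverse) simp
  show ?thesis
  proof
    assume "h = fps_quot f g"
    then have "h * g = f * (g * fps_right_inverse g 1)"
      by (simp only: fps_quot_def mult_ac)
    then show "h * g = f"
      by (simp only: inv mult_1_right)
  next
    assume "h * g = f"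
    then have "fps_quot f g = h * (g * fps_right_inverse g 1)"
      by (simp only: fps_quot_def mult.assoc flip: \<open>h * g = f\<close>)
    then show "h = fps_quot f g"
      by (simp only: inv mult_1_right)
  qed
qed

end

theory Submission
  imports Defs
begin

text \<open>
  Let \<open>G\<^sub>n(z) = E(z\<^bsup>S\<^sub>n\<^esup>)\<close>, the coefficient of \<open>v\<^sup>n\<close> in \<open>Q(z,v)\<close>. On \<open>{0,1}\<close> every function is affine
  in the indicator of either value, so \<open>z\<^bsup>X\<^sub>i\<^esup> = a + b Y\<^sub>i\<close> in two ways: with \<open>Y\<^sub>i\<close> the indicator of
  \<open>X\<^sub>i = 0\<close>, \<open>a = z\<close>, \<open>b = 1 - z\<close>; and with \<open>Y\<^sub>i\<close> the indicator of \<open>X\<^sub>i = 1\<close>, \<open>a = 1\<close>, \<open>b = -(1 - z)\<close>.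

  Expand the product of the factors \<open>a + b Y\<^sub>i\<close>, \<open>1 \<le> i \<le> n\<close>, according to the first index \<open>j + 1\<close>
  from which \<open>a\<close> is taken (\<open>prod_affine_expand\<close>). That term is
  \<open>b\<^sup>j Y\<^sub>1 \<dots> Y\<^sub>j a z\<^bsup>X\<^sub>j\<^sub>+\<^sub>2\<^esup> \<dots> z\<^bsup>X\<^sub>n\<^esup>\<close>: the variable \<open>X\<^sub>j\<^sub>+\<^sub>1\<close> has dropped out. The two remaining blocks are
  therefore independent by 1-dependence, and by stationarity the second one has expectation
  \<open>G\<^sub>n\<^sub>-\<^sub>j\<^sub>-\<^sub>1(z)\<close> (\<open>expectation_prod_gap\<close>). With \<open>R\<^sub>j = E(Y\<^sub>1 \<dots> Y\<^sub>j)\<close>, the probability of a run of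
  length \<open>j\<close>, this says
  \<open>G\<^sub>n = b\<^sup>n R\<^sub>n + (\<Sum>j<n. a b\<^sup>j R\<^sub>j G\<^sub>n\<^sub>-\<^sub>j\<^sub>-\<^sub>1)\<close>, that is, \<open>Q(z,v) = R(bv) + a v R(bv) Q(z,v)\<close> for the generating
  function \<open>R\<close> of the run probabilities (\<open>bivariate_gf_renewal\<close>). The two choices of \<open>a\<close>, \<open>b\<close>, \<open>Y\<close>
  make \<open>R\<close> the 0-run and the 1-run generating function, and solving for \<open>Q(z,v)\<close> gives the two
  formulae.
\<close>

section \<open>Expanding a product of affine factors\<close>

text \<open>
  The summand \<open>j\<close> collects the choices in which \<open>b * y\<close> is taken from the first \<open>j\<close> factors and \<open>a\<close>
  from the factor \<open>j + 1\<close>; the later factors stay unexpanded.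
\<close>

lemma prod_affine_expand:
  fixes a b :: "'a::comm_ring_1"
  shows "(\<Prod>i=1..n. a + b * y i) =
    b ^ n * (\<Prod>i=1..n. y i) +
    (\<Sum>j<n. a * b ^ j * ((\<Prod>i=1..j. y i) * (\<Prod>i=j+2..n. a + b * y i)))"
proof (induction n)
  case 0
  then show ?case by simp
next
  case (Suc n)
  have last: "(\<Prod>i=j+2..Suc n. a + b * y i) = (\<Prod>i=j+2..n. a + b * y i) * (a + b * y (Suc n))"
    if "j < n" for j
    using that by simp
  have "(\<Prod>i=1..Suc n. a + b * y i) = (\<Prod>i=1..n. a + b * y i) * (a + b * y (Suc n))"
    by simp
  also have "\<dots> = b ^ Suc n * (\<Prod>i=1..Suc n. y i) + a * b ^ n * (\<Prod>i=1..n. y i) +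
    (\<Sum>j<n. a * b ^ j * ((\<Prod>i=1..j. y i) * (\<Prod>i=j+2..n. a + b * y i))) * (a + b * y (Suc n))"
    unfolding Suc.IH by (simp add: algebra_simps)
  also have "(\<Sum>j<n. a * b ^ j * ((\<Prod>i=1..j. y i) * (\<Prod>i=j+2..n. a + b * y i))) * (a + b * y (Suc n)) =
    (\<Sum>j<n. a * b ^ j * ((\<Prod>i=1..j. y i) * (\<Prod>i=j+2..Suc n. a + b * y i)))"
    unfolding sum_distrib_right
    by (intro sum.cong refl, subst last) (simp_all add: mult_ac)
  finally show ?case
    by (simp add: algebra_simps)
qed

section \<open>Product expectations of the sequence\<close>

lemma random_sequence_values:
  assumes "random_sequence M (count_space {0, 1}) X" "\<omega> \<in> space M" "i \<ge> 1"
  shows "X i \<omega> \<in> {0, 1::nat}"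
  using assms measurable_space[of "X i" M "count_space {0, 1}" \<omega>]
  by (auto simp: random_sequence_def)

lemma measurable_prod_components:
  fixes f :: "'b \<Rightarrow> real"
  assumes "finite J" "J \<subseteq> I"
  shows "(\<lambda>x. \<Prod>i\<in>J. f (x i)) \<in> borel_measurable (\<Pi>\<^sub>M i\<in>I. count_space A)"
proof (rule borel_measurable_prod)
  fix i assume "i \<in> J"
  then have "(\<lambda>x. x i) \<in> (\<Pi>\<^sub>M i\<in>I. count_space A) \<rightarrow>\<^sub>M count_space A"
    using assms by (intro measurable_component_singleton) auto
  then show "(\<lambda>x. f (x i)) \<in> borel_measurable (\<Pi>\<^sub>M i\<in>I. count_space A)"
    by (rule measurable_compose) simp
qed

context prob_space
begin

text \<open>
  The function is allowed to vary with the index, so that products over two blocks with a different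
  function on each block are covered.
\<close>

lemma integrable_prod_values:
  fixes f :: "nat \<Rightarrow> nat \<Rightarrow> real"
  assumes X: "random_sequence M (count_space {0, 1}) X" and "finite J" "\<forall>i\<in>J. i \<ge> 1"
  shows "integrable M (\<lambda>\<omega>. \<Prod>i\<in>J. f i (X i \<omega>))"
proof (rule integrable_const_bound)
  show "(\<lambda>\<omega>. \<Prod>i\<in>J. f i (X i \<omega>)) \<in> borel_measurable M"
  proof (rule borel_measurable_prod)
    fix i assume "i \<in> J"
    then have "X i \<in> M \<rightarrow>\<^sub>M count_space {0, 1}"
      using assms by (auto simp: random_sequence_def)
    then show "(\<lambda>\<omega>. f i (X i \<omega>)) \<in> borel_measurable M"
      by (rule measurable_compose) simp
  qed
  have "norm (\<Prod>i\<in>J. f i (X i \<omega>)) \<le> (\<Prod>i\<in>J. \<bar>f i 0\<bar> + \<bar>f i 1\<bar>)" if "\<omega> \<in> space M" for \<omega>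
    unfolding prod_norm[symmetric]
  proof (intro prod_mono conjI)
    fix i assume "i \<in> J"
    with assms(3) have "X i \<omega> \<in> {0, 1}"
      by (intro random_sequence_values[OF X that]) simp
    then show "norm (f i (X i \<omega>)) \<le> \<bar>f i 0\<bar> + \<bar>f i 1\<bar>"
      by auto
  qed simp
  then show "AE \<omega> in M. norm (\<Prod>i\<in>J. f i (X i \<omega>)) \<le> (\<Prod>i\<in>J. \<bar>f i 0\<bar> + \<bar>f i 1\<bar>)"
    by (intro AE_I2)
qed

text \<open>
  Stationarity shifts the indices \<open>1..n\<close> by one only. A block that starts later is regarded as a
  function of the longer vector that starts at index 1, and the shifts are then iterated.
\<close>

lemma expectation_prod_shift:
  fixes f :: "nat \<Rightarrow> real"
  assumes X: "random_sequence M (count_space {0, 1}) X"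
    and stat: "stationary M (count_space {0, 1}) X"
  shows "expectation (\<lambda>\<omega>. \<Prod>i=j+1..j+m. f (X i \<omega>)) = expectation (\<lambda>\<omega>. \<Prod>i=1..m. f (X i \<omega>))"
proof (induction j)
  case 0
  then show ?case by simp
next
  case (Suc j)
  show ?case
  proof (cases "j + m = 0")
    case True
    then show ?thesis by simp
  next
    case False
    let ?I = "{1..j+m}" and ?B = "{j+1..j+m}"
    let ?N = "\<Pi>\<^sub>M i\<in>?I. count_space {0, 1::nat}"
    let ?F = "\<lambda>x. \<Prod>i\<in>?B. f (x i)"
    have F: "?F \<in> borel_measurable ?N"
      by (rule measurable_prod_components) auto
    have V: "(\<lambda>\<omega>. \<lambda>i\<in>?I. X (i + d) \<omega>) \<in> M \<rightarrow>\<^sub>M ?N" for d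
      using X by (intro measurable_restrict) (auto simp: random_sequence_def)
    have dist: "distr M ?N (\<lambda>\<omega>. \<lambda>i\<in>?I. X i \<omega>) = distr M ?N (\<lambda>\<omega>. \<lambda>i\<in>?I. X (i + 1) \<omega>)"
    proof -
      have "j + m \<ge> 1"
        using False by linarith
      then show ?thesis
        by (rule stat[unfolded stationary_def, rule_format])
    qed
    have "(\<Prod>i=Suc j+1..Suc j+m. f (X i \<omega>)) = ?F (\<lambda>i\<in>?I. X (i + 1) \<omega>)" for \<omega>
    proof -
      have "(\<Prod>i=Suc j+1..Suc j+m. f (X i \<omega>)) = (\<Prod>i\<in>?B. f (X (i + 1) \<omega>))"
        using prod.shift_bounds_cl_Suc_ivl[of "\<lambda>i. f (X i \<omega>)" "j+1" "j+m"] by simp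
      also have "\<dots> = ?F (\<lambda>i\<in>?I. X (i + 1) \<omega>)"
        by (intro prod.cong) auto
      finally show ?thesis .
    qed
    then have "expectation (\<lambda>\<omega>. \<Prod>i=Suc j+1..Suc j+m. f (X i \<omega>)) =
        expectation (\<lambda>\<omega>. ?F (\<lambda>i\<in>?I. X (i + 1) \<omega>))"
      by (simp only:)
    also have "\<dots> = integral\<^sup>L (distr M ?N (\<lambda>\<omega>. \<lambda>i\<in>?I. X (i + 1) \<omega>)) ?F"
      by (rule integral_distr[OF V F, symmetric])
    also have "\<dots> = integral\<^sup>L (distr M ?N (\<lambda>\<omega>. \<lambda>i\<in>?I. X i \<omega>)) ?F"
      by (simp only: dist)
    also have "\<dots> = expectation (\<lambda>\<omega>. ?F (\<lambda>i\<in>?I. X i \<omega>))"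
      by (rule integral_distr[OF V[of 0, unfolded add_0_right] F])
    also have "\<dots> = expectation (\<lambda>\<omega>. \<Prod>i\<in>?B. f (X i \<omega>))"
      by (intro Bochner_Integration.integral_cong refl prod.cong) auto
    finally show ?thesis
      using Suc.IH by simp
  qed
qed

text \<open>
  The index \<open>j + 1\<close> is missing between the two blocks, which is exactly the gap that makes them
  independent in a 1-dependent sequence; stationarity then moves the second block to the front.
\<close>

lemma expectation_prod_gap:
  fixes f g :: "nat \<Rightarrow> real"
  assumes X: "random_sequence M (count_space {0, 1}) X"
    and stat: "stationary M (count_space {0, 1}) X"
    and dep: "one_dependent M (count_space {0, 1}) X"
    and "j < n"
  shows "expectation (\<lambda>\<omega>. (\<Prod>i=1..j. f (X i \<omega>)) * (\<Prod>i=j+2..n. g (X i \<omega>))) =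
    expectation (\<lambda>\<omega>. \<Prod>i=1..j. f (X i \<omega>)) * expectation (\<lambda>\<omega>. \<Prod>i=1..n-(j+1). g (X i \<omega>))"
proof (cases "n = j + 1")
  \<comment> \<open>Here the second block is empty, whereas 1-dependence speaks of nonempty second blocks.\<close>
  case True
  then show ?thesis by (simp add: prob_space)
next
  case False
  define k where "k = n - (j + 1)"
  have k: "k \<ge> 1" "n = j + 1 + k"
    using False \<open>j < n\<close> by (auto simp: k_def)
  let ?I = "{1..<j+1}" and ?J = "{(j+1)+1..(j+1)+k}"
  let ?A = "\<lambda>x. \<Prod>i\<in>?I. f (x i)" and ?C = "\<lambda>x. \<Prod>i\<in>?J. g (x i)"
  have "indep_var (\<Pi>\<^sub>M i\<in>?I. count_space {0, 1}) (\<lambda>\<omega>. \<lambda>i\<in>?I. X i \<omega>)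
      (\<Pi>\<^sub>M i\<in>?J. count_space {0, 1}) (\<lambda>\<omega>. \<lambda>i\<in>?J. X i \<omega>)"
    using dep[unfolded one_dependent_def, rule_format, of "j + 1" k] k(1) by simp
  then have "indep_var borel (?A \<circ> (\<lambda>\<omega>. \<lambda>i\<in>?I. X i \<omega>)) borel (?C \<circ> (\<lambda>\<omega>. \<lambda>i\<in>?J. X i \<omega>))"
    by (rule indep_var_compose) (rule measurable_prod_components; simp)+
  moreover have "?A \<circ> (\<lambda>\<omega>. \<lambda>i\<in>?I. X i \<omega>) = (\<lambda>\<omega>. \<Prod>i=1..j. f (X i \<omega>))"
    unfolding o_def by (intro ext prod.cong) auto
  moreover have "?C \<circ> (\<lambda>\<omega>. \<lambda>i\<in>?J. X i \<omega>) = (\<lambda>\<omega>. \<Prod>i=j+2..n. g (X i \<omega>))"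
    unfolding o_def k(2) by (intro ext prod.cong) auto
  ultimately have "indep_var borel (\<lambda>\<omega>. \<Prod>i=1..j. f (X i \<omega>)) borel (\<lambda>\<omega>. \<Prod>i=j+2..n. g (X i \<omega>))"
    by (simp only:)
  then have "expectation (\<lambda>\<omega>. (\<Prod>i=1..j. f (X i \<omega>)) * (\<Prod>i=j+2..n. g (X i \<omega>))) =
      expectation (\<lambda>\<omega>. \<Prod>i=1..j. f (X i \<omega>)) * expectation (\<lambda>\<omega>. \<Prod>i=j+2..n. g (X i \<omega>))"
  proof (rule indep_var_lebesgue_integral)
    show "integrable M (\<lambda>\<omega>. \<Prod>i=1..j. f (X i \<omega>))"
      by (rule integrable_prod_values[OF X, where f = "\<lambda>_. f"]; simp)
    show "integrable M (\<lambda>\<omega>. \<Prod>i=j+2..n. g (X i \<omega>))"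
      by (rule integrable_prod_values[OF X, where f = "\<lambda>_. g"]; simp)
  qed
  also have "expectation (\<lambda>\<omega>. \<Prod>i=j+2..n. g (X i \<omega>)) = expectation (\<lambda>\<omega>. \<Prod>i=1..k. g (X i \<omega>))"
    using expectation_prod_shift[OF X stat, of g "j + 1" k] by (simp add: k(2))
  finally show ?thesis
    by (simp only: k_def)
qed

section \<open>The renewal equation for the bivariate generating function\<close>

lemma poly_bivariate_gf:
  assumes X: "random_sequence M (count_space {0, 1}) X"
  shows "poly (fps_nth (bivariate_gf M X) n) t = expectation (\<lambda>\<omega>. \<Prod>i=1..n. t ^ X i \<omega>)"
proof -
  let ?E = "\<lambda>k. {\<omega> \<in> space M. partial_sum X n \<omega> = k}"
  have "X i \<in> measurable M (count_space UNIV)" if "i \<in> {1..n}" for i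
  proof -
    have "X i \<in> M \<rightarrow>\<^sub>M count_space {0, 1}"
      using X that by (simp add: random_sequence_def)
    from measurable_compose[OF this, of "\<lambda>x. x" "count_space UNIV"] show ?thesis
      by simp
  qed
  then have meas: "partial_sum X n \<in> measurable M (count_space UNIV)"
    unfolding partial_sum_def[abs_def] by measurable
  have E: "?E k \<in> events" for k
    using meas by measurable
  have "(\<Prod>i=1..n. t ^ X i \<omega>) = (\<Sum>k\<le>n. t ^ k * indicator (?E k) \<omega>)" if w: "\<omega> \<in> space M" for \<omega>
  proof -
    have "partial_sum X n \<omega> \<le> (\<Sum>i=1..n. 1)"
      unfolding partial_sum_def using random_sequence_values[OF X w] by (intro sum_mono) force
    then have "(\<Sum>k\<le>n. t ^ k * indicator (?E k) \<omega>) = t ^ partial_sum X n \<omega>"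
      using w by (simp add: indicator_def if_distrib sum.delta cong: if_cong)
    then show ?thesis
      by (simp add: partial_sum_def power_sum)
  qed
  then have "expectation (\<lambda>\<omega>. \<Prod>i=1..n. t ^ X i \<omega>) =
      expectation (\<lambda>\<omega>. \<Sum>k\<le>n. t ^ k * indicator (?E k) \<omega>)"
    by (intro Bochner_Integration.integral_cong refl) auto
  also have "\<dots> = (\<Sum>k\<le>n. expectation (\<lambda>\<omega>. t ^ k * indicator (?E k) \<omega>))"
    using E by (intro Bochner_Integration.integral_sum integrable_mult_right integrable_real_indicator)
      (auto simp: emeasure_eq_measure)
  also have "\<dots> = (\<Sum>k\<le>n. t ^ k * prob (?E k))"
    using E by (intro sum.cong refl) (simp add: Int_absorb2)
  finally show ?thesis
    by (simp add: bivariate_gf_def poly_sum poly_monom mult_ac)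
qed

text \<open>
  The hypothesis on \<open>y\<close> is an identity of polynomials in \<open>z\<close>. The recursion for the coefficients is
  proved at each real value \<open>t\<close> of \<open>z\<close>, where it is an identity of expectations, and a real
  polynomial is determined by its values.
\<close>

lemma bivariate_gf_renewal:
  fixes a b :: "real poly" and y :: "nat \<Rightarrow> real"
  assumes X: "random_sequence M (count_space {0, 1}) X"
    and stat: "stationary M (count_space {0, 1}) X"
    and dep: "one_dependent M (count_space {0, 1}) X"
    and affine: "\<And>x. x \<in> {0, 1} \<Longrightarrow> [:0, 1:] ^ x = a + b * [:y x:]"
    and R: "\<And>n. fps_nth R n = expectation (\<lambda>\<omega>. \<Prod>i=1..n. y (X i \<omega>))"
  defines "F \<equiv> fps_of_real_fps R oo (fps_const b * fps_X)"
  shows "bivariate_gf M X = F + fps_const a * fps_X * F * bivariate_gf M X"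
proof (rule fps_ext)
  fix n
  define G where "G = (\<lambda>n. fps_nth (bivariate_gf M X) n)"
  have F: "fps_nth F n = b ^ n * [:fps_nth R n:]" for n
    by (simp add: F_def fps_of_real_fps_def fps_compose_linear)
  have "G n = fps_nth F n + (\<Sum>j<n. a * fps_nth F j * G (n - (j + 1)))"
  proof (rule poly_eq_poly_eq_iff[THEN iffD1], rule ext)
    fix t
    let ?a = "poly a t" and ?b = "poly b t"
    let ?r = "\<lambda>j \<omega>. \<Prod>i=1..j. y (X i \<omega>)"
    let ?g = "\<lambda>j \<omega>. \<Prod>i=j+2..n. t ^ X i \<omega>"
    have fac: "t ^ X i \<omega> = ?a + ?b * y (X i \<omega>)" if "\<omega> \<in> space M" "i \<ge> 1" for i \<omega>
      using arg_cong[OF affine[OF random_sequence_values[OF X that]], of "\<lambda>p. poly p t"] by simp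
    have expand: "(\<Prod>i=1..n. t ^ X i \<omega>) =
        ?b ^ n * ?r n \<omega> + (\<Sum>j<n. ?a * ?b ^ j * (?r j \<omega> * ?g j \<omega>))" if w: "\<omega> \<in> space M" for \<omega>
    proof -
      have block: "(\<Prod>i=j..n. t ^ X i \<omega>) = (\<Prod>i=j..n. ?a + ?b * y (X i \<omega>))" if "j \<ge> 1" for j
        using w that by (intro prod.cong) (auto simp: fac)
      show ?thesis
        using prod_affine_expand[of ?a ?b "\<lambda>i. y (X i \<omega>)" n] by (simp add: block)
    qed
    have int_r: "integrable M (?r j)" for j
      by (auto intro!: integrable_prod_values[where f = "\<lambda>_. y"] X)
    have int_rg: "integrable M (\<lambda>\<omega>. ?r j \<omega> * ?g j \<omega>)" for j
    proof -
      let ?h = "\<lambda>i x. if i \<le> j then y x else t ^ x"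
      have "?r j \<omega> * ?g j \<omega> = (\<Prod>i\<in>{1..j} \<union> {j+2..n}. ?h i (X i \<omega>))" for \<omega>
      proof -
        have "?r j \<omega> = (\<Prod>i=1..j. ?h i (X i \<omega>))" "?g j \<omega> = (\<Prod>i=j+2..n. ?h i (X i \<omega>))"
          by (auto intro!: prod.cong)
        then show ?thesis
          by (subst prod.union_disjoint) auto
      qed
      then show ?thesis
        by (simp only:) (rule integrable_prod_values[OF X, where f = ?h]; auto)
    qed
    have "poly (G n) t = expectation (\<lambda>\<omega>. \<Prod>i=1..n. t ^ X i \<omega>)"
      by (simp add: G_def poly_bivariate_gf[OF X])
    also have "\<dots> = expectation (\<lambda>\<omega>. ?b ^ n * ?r n \<omega> + (\<Sum>j<n. ?a * ?b ^ j * (?r j \<omega> * ?g j \<omega>)))"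
      by (intro Bochner_Integration.integral_cong refl expand)
    also have "\<dots> = ?b ^ n * expectation (?r n) +
        (\<Sum>j<n. ?a * ?b ^ j * expectation (\<lambda>\<omega>. ?r j \<omega> * ?g j \<omega>))"
      using int_r int_rg by simp
    also have "\<dots> = ?b ^ n * expectation (?r n) +
        (\<Sum>j<n. ?a * ?b ^ j * (expectation (?r j) * poly (G (n - (j + 1))) t))"
      by (intro arg_cong2[where f = "(+)"] sum.cong refl, subst expectation_prod_gap[OF X stat dep])
        (auto simp: G_def poly_bivariate_gf[OF X])
    finally show "poly (G n) t = poly (fps_nth F n + (\<Sum>j<n. a * fps_nth F j * G (n - (j + 1)))) t"
      by (simp add: F R poly_sum mult_ac)
  qed
  also have "(\<Sum>j<n. a * fps_nth F j * G (n - (j + 1))) =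
      fps_nth (fps_const a * fps_X * F * bivariate_gf M X) n"
  proof (cases n)
    case 0
    then show ?thesis by simp
  next
    case (Suc m)
    have comm: "fps_const a * fps_X * F * bivariate_gf M X = fps_X * (fps_const a * (F * bivariate_gf M X))"
      by (simp only: mult_ac)
    have "fps_nth (fps_const a * fps_X * F * bivariate_gf M X) n =
        a * fps_nth (F * bivariate_gf M X) m"
      by (simp only: comm) (simp add: Suc)
    also have "\<dots> = (\<Sum>j\<le>m. a * fps_nth F j * G (m - j))"
      by (simp only: fps_mult_nth G_def sum_distrib_left mult.assoc atMost_atLeast0)
    finally show ?thesis
      by (simp only: Suc lessThan_Suc_atMost add_Suc_right add_0_right One_nat_def diff_Suc_Suc)
  qed
  finally show "fps_nth (bivariate_gf M X) n =
      fps_nth (F + fps_const a * fps_X * F * bivariate_gf M X) n"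
    by (simp add: G_def)
qed

section \<open>The two run generating functions\<close>

text \<open>
  Since \<open>0\<close> and \<open>1\<close> are the extreme values of a summand, a sum of \<open>n\<close> summands equals \<open>c n\<close> only if all
  of them equal \<open>c\<close>. The form \<open>c n\<close> covers the 0-runs and the 1-runs at once.
\<close>

lemma run_probability:
  assumes X: "random_sequence M (count_space {0, 1}) X" and c: "c \<in> {0, 1}"
  shows "\<P>(\<omega> in M. partial_sum X n \<omega> = c * n) = expectation (\<lambda>\<omega>. \<Prod>i=1..n. of_bool (X i \<omega> = c))"
proof -
  let ?E = "{\<omega> \<in> space M. partial_sum X n \<omega> = c * n}"
  have eq: "(\<Prod>i=1..n. of_bool (X i \<omega> = c)) = (indicator ?E \<omega> :: real)" if w: "\<omega> \<in> space M" for \<omega>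
  proof -
    have v: "X i \<omega> = 0 \<or> X i \<omega> = 1" if "i \<in> {1..n}" for i
      using random_sequence_values[OF X w, of i] that by auto
    have "partial_sum X n \<omega> = c * n \<longleftrightarrow> (\<forall>i\<in>{1..n}. X i \<omega> = c)"
    proof (cases "c = 0")
      case True
      then show ?thesis by (simp add: partial_sum_def)
    next
      case False
      then have "c = 1" using c by simp
      have "(\<Sum>i=1..n. X i \<omega>) + (\<Sum>i=1..n. 1 - X i \<omega>) = (\<Sum>i=1..n. 1)"
        unfolding sum.distrib[symmetric] using v by (intro sum.cong refl) force
      then have "partial_sum X n \<omega> + (\<Sum>i=1..n. 1 - X i \<omega>) = n"
        by (simp add: partial_sum_def)
      then have "partial_sum X n \<omega> = n \<longleftrightarrow> (\<Sum>i=1..n. 1 - X i \<omega>) = 0"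
        by linarith
      also have "\<dots> \<longleftrightarrow> (\<forall>i\<in>{1..n}. X i \<omega> = 1)"
        using v by (subst sum_eq_0_iff) force+
      finally show ?thesis using \<open>c = 1\<close> by simp
    qed
    moreover have "(\<Prod>i=1..n. of_bool (X i \<omega> = c)) = (of_bool (\<forall>i\<in>{1..n}. X i \<omega> = c) :: real)"
    proof (cases "\<forall>i\<in>{1..n}. X i \<omega> = c")
      case True
      then show ?thesis by simp
    next
      case False
      then have "(\<Prod>i=1..n. of_bool (X i \<omega> = c)) = (0 :: real)"
        by (intro prod_zero) auto
      then show ?thesis
        using False by (simp only: of_bool_eq(1))
    qed
    ultimately have "(\<Prod>i=1..n. of_bool (X i \<omega> = c)) = (of_bool (partial_sum X n \<omega> = c * n) :: real)"
      by (simp only:)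
    then show ?thesis
      using w by (simp only: indicator_def mem_Collect_eq simp_thms)
  qed
  have "expectation (\<lambda>\<omega>. \<Prod>i=1..n. of_bool (X i \<omega> = c)) = expectation (indicator ?E :: 'a \<Rightarrow> real)"
    by (rule Bochner_Integration.integral_cong[OF refl eq])
  also have "\<dots> = prob ?E"
    by (simp add: Int_absorb2)
  finally show ?thesis by simp
qed

end

theorem theorem2p1:
  fixes M :: "'a measure" and X :: "nat \<Rightarrow> 'a \<Rightarrow> nat"
    and z v :: "real poly fps" and Q P :: "real poly fps \<Rightarrow> real poly fps"
  assumes "prob_space M"
    and "random_sequence M (count_space {0, 1}) X"
    and "stationary M (count_space {0, 1}) X"
    and "one_dependent M (count_space {0, 1}) X"
  defines "z \<equiv> fps_const [:0, 1:]"
    and "v \<equiv> fps_X"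
    and "Q \<equiv> \<lambda>w. fps_of_real_fps (zero_run_gf M X) oo w"
    and "P \<equiv> \<lambda>w. fps_of_real_fps (one_run_gf M X) oo w"
  shows "bivariate_gf M X = fps_quot (Q ((1 - z) * v)) (1 - z * v * Q ((1 - z) * v)) \<and>
         bivariate_gf M X = fps_quot (P (- ((1 - z) * v))) (1 - v * P (- ((1 - z) * v)))"
proof -
  interpret prob_space M by fact
  let ?b = "1 - [:0, 1:] :: real poly"
  have b: "(1 - z) * v = fps_const ?b * fps_X"
    unfolding z_def v_def fps_const_1_eq_1[symmetric] fps_const_sub ..
  then have minus_b: "- ((1 - z) * v) = fps_const (- ?b) * fps_X"
    by (simp only: fps_const_neg[symmetric] mult_minus_left)
  have zero: "bivariate_gf M X = Q ((1 - z) * v) + z * v * Q ((1 - z) * v) * bivariate_gf M X"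
    unfolding b unfolding z_def v_def Q_def
  proof (rule bivariate_gf_renewal[OF assms(2-4), where y = "\<lambda>x. of_bool (x = 0)"])
    fix n
    show "fps_nth (zero_run_gf M X) n = expectation (\<lambda>\<omega>. \<Prod>i=1..n. of_bool (X i \<omega> = 0))"
      using run_probability[OF assms(2), of 0 n] by (simp add: zero_run_gf_def)
  qed (auto simp: one_pCons)
  have one: "bivariate_gf M X =
      P (- ((1 - z) * v)) + fps_const 1 * v * P (- ((1 - z) * v)) * bivariate_gf M X"
    unfolding minus_b unfolding v_def P_def
  proof (rule bivariate_gf_renewal[OF assms(2-4), where y = "\<lambda>x. of_bool (x = 1)"])
    fix n
    show "fps_nth (one_run_gf M X) n = expectation (\<lambda>\<omega>. \<Prod>i=1..n. of_bool (X i \<omega> = 1))"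
      using run_probability[OF assms(2), of 1 n] by (simp add: one_run_gf_def)
  qed (auto simp: one_pCons)
  \<comment> \<open>A renewal equation whose kernel has no constant term in \<open>v\<close> determines its solution.\<close>
  have solve: "G = fps_quot A (1 - C)" if "G = A + C * G" "fps_nth C 0 = 0"
    for G A C :: "real poly fps"
  proof -
    have "G * (1 - C) = A"
      using that(1) by (simp add: algebra_simps)
    then show ?thesis
      using that(2) by (simp add: fps_quot_eq_iff)
  qed
  show ?thesis
  proof
    show "bivariate_gf M X = fps_quot (Q ((1 - z) * v)) (1 - z * v * Q ((1 - z) * v))"
      using zero by (rule solve) (simp add: v_def)
    show "bivariate_gf M X = fps_quot (P (- ((1 - z) * v))) (1 - v * P (- ((1 - z) * v)))"
      using one by (intro solve) (simp_all add: v_def)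
  qed
qed

end
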